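(* If $\alpha\models n$, then $$\nabla(\mathbf{s}_\alpha)=(-1)^{n+\ell(\alpha)}\,q^{n(\alpha')}\,t^{n(\alpha^c)}\sum_{\beta\le\alpha^c}\ \prod_{i\in D(\alpha)\cap D(\beta)}(t^i+q^{n-i})\ \mathbf{s}_\beta ,$$ where $\nabla$ is the linear operator on $NC\Lambda$ defined by $\nabla(\widetilde{\mathbf{H}}_\alpha^{qt})=t^{n(\alpha)}q^{n(\alpha')}\widetilde{\mathbf{H}}_\alpha^{qt}$ for all compositions $\alpha$.
   Context: A composition $\alpha$ of a positive integer $n$ ($\alpha\models n$) is a sequence $(\alpha_1,\dots,\alpha_\ell)$ of positive integers with sum $n$; $|\alpha|=n$, $\ell(\alpha)=\ell$. The descent set is $D(\alpha)=\{\alpha_1,\alpha_1+\alpha_2,\dots,\alpha_1+\cdots+\alpha_{\ell-1}\}\subseteq\{1,\dots,n-1\}$; $\alpha\mapsto D(\alpha)$ is a bijection onto subsets of $\{1,\dots,n-1\}$. For compositions of the same $n$, $\alpha\le\beta$ (equivalently $\beta\ge\alpha$) means $D(\beta)\subseteq D(\alpha)$. Involutions: $\overleftarrow{\alpha}=(\alpha_\ell,\dots,\alpha_1)$; $\alpha^c$ is the composition of $n$ with $D(\alpha^c)=\{1,\dots,n-1\}\setminus D(\alpha)$; $\alpha'=\overleftarrow{\alpha^c}$. Statistics: $n(\alpha)=\sum_{i\in D(\alpha)}i$ (not to be confused with the integer $n$), and for $\alpha,\beta\models n$, $c(\alpha,\beta)=\sum_{i\in D(\alpha)\cap D(\beta)}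 i$. $NC\Lambda$ is the free associative algebra on $\mathbf{h}_1,\mathbf{h}_2,\dots$ over $\mathbb{Q}$, with coefficients extended to $\mathbb{Q}(q,t)$. Put $\mathbf{h}_\alpha=\mathbf{h}_{\alpha_1}\cdots\mathbf{h}_{\alpha_\ell}$. The ribbon Schur functions $\mathbf{s}_\alpha=\sum_{\beta\ge\alpha}(-1)^{\ell(\alpha)-\ell(\beta)}\mathbf{h}_\beta$, $\alpha\models n$, form a basis of the degree $n$ part ($\deg\mathbf{h}_k=k$). Define $\widetilde{\mathbf{H}}_\alpha^{qt}=\sum_{\beta\models|\alpha|}t^{c(\alpha,\beta)}q^{c(\alpha',\overleftarrow{\beta})}\,\mathbf{s}_\beta$; for $\alpha\models n$ these also form a basis of the degree $n$ part over $\mathbb{Q}(q,t)$. *)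

theory Defs
  imports
    "HOL-Computational_Algebra.Fraction_Field"
    "HOL-Computational_Algebra.Polynomial"
    "HOL-Library.Poly_Mapping"
begin

section \<open>Compositions\<close>

text \<open>
  The empty sequence, the composition of 0, is included: compositions are at the same time the
  words in the generators of the free associative algebra below, and the empty word is its unit.
\<close>

typedef composition = "{xs :: nat list. \<forall>x\<in>set xs. 0 < x}"
  morphisms parts Composition
  by (rule exI[of _ "[]"]) simp

setup_lifting type_definition_composition

instantiation composition :: monoid_add
begin

lift_definition zero_composition :: composition is "[]"
  by simp

lift_definition plus_composition :: "composition \<Rightarrow> composition \<Rightarrow> composition" is "(@)"
  by auto

instance
  by standard (transfer; simp)+

end

definition weight :: "composition \<Rightarrow> nat" where
  "weight \<alpha> = sum_list (parts \<alpha>)"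

definition len :: "composition \<Rightarrow> nat" where
  "len \<alpha> = length (parts \<alpha>)"

definition is_composition_of :: "composition \<Rightarrow> nat \<Rightarrow> bool" (infix "\<Turnstile>" 50) where
  "\<alpha> \<Turnstile> n \<longleftrightarrow> weight \<alpha> = n"

definition descents :: "composition \<Rightarrow> nat set" where
  "descents \<alpha> = {sum_list (take k (parts \<alpha>)) | k. 1 \<le> k \<and> k < len \<alpha>}"

text \<open>The smaller composition is the finer one.\<close>

definition finer :: "composition \<Rightarrow> composition \<Rightarrow> bool" (infix "\<preceq>" 50) where
  "\<alpha> \<preceq> \<beta> \<longleftrightarrow> weight \<alpha> = weight \<beta> \<and> descents \<beta> \<subseteq> descents \<alpha>"

lift_definition reversal :: "composition \<Rightarrow> composition" is rev
  by simp

definition complement :: "composition \<Rightarrow> composition" where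
  "complement \<alpha> =
     (THE \<gamma>. \<gamma> \<Turnstile> weight \<alpha> \<and> descents \<gamma> = {1..<weight \<alpha>} - descents \<alpha>)"

definition conjugate :: "composition \<Rightarrow> composition" where
  "conjugate \<alpha> = reversal (complement \<alpha>)"

definition nstat :: "composition \<Rightarrow> nat" where
  "nstat \<alpha> = \<Sum>(descents \<alpha>)"

definition cstat :: "composition \<Rightarrow> composition \<Rightarrow> nat" where
  "cstat \<alpha> \<beta> = \<Sum>(descents \<alpha> \<inter> descents \<beta>)"

text \<open>
  The next facts show that the sums over compositions below are finite sums and that the
  description of \<^const>\<open>complement\<close> denotes.
\<close>

lemma finite_compositions: "finite {\<alpha>. \<alpha> \<Turnstile> n}"
proof -
  have len_le: "length xs \<le> sum_list xs" if "\<forall>x\<in>set xs. 0 < x" for xs :: "nat list"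
    using that by (induction xs) auto
  have "parts ` {\<alpha>. \<alpha> \<Turnstile> n} \<subseteq> {xs. set xs \<subseteq> {..n} \<and> length xs \<le> n}"
  proof
    fix xs assume "xs \<in> parts ` {\<alpha>. \<alpha> \<Turnstile> n}"
    then obtain \<alpha> where \<alpha>: "xs = parts \<alpha>" "sum_list xs = n"
      by (auto simp: is_composition_of_def weight_def)
    have "\<forall>x\<in>set xs. 0 < x"
      using parts[of \<alpha>] \<alpha>(1) by simp
    then have "length xs \<le> n"
      using len_le \<alpha>(2) by blast
    moreover have "set xs \<subseteq> {..n}"
      using member_le_sum_list \<alpha>(2) by fastforce
    ultimately show "xs \<in> {xs. set xs \<subseteq> {..n} \<and> length xs \<le> n}"
      by simp
  qed
  then have "finite (parts ` {\<alpha>. \<alpha> \<Turnstile> n})"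
    by (rule finite_subset) (rule finite_lists_length_le, simp)
  then show ?thesis
    by (rule finite_imageD) (simp add: inj_on_def parts_inject)
qed

lemma descents_snoc:
  assumes "parts \<beta> = parts \<alpha> @ [x]"
  shows "descents \<beta> = (if parts \<alpha> = [] then {} else insert (weight \<alpha>) (descents \<alpha>))"
proof -
  have "descents \<beta> = {sum_list (take k (parts \<alpha>)) | k. 1 \<le> k \<and> k \<le> len \<alpha>}"
    unfolding descents_def len_def assms
    by (rule Collect_cong, rule ex_cong1) (auto simp: less_Suc_eq_le)
  also have "{k. 1 \<le> k \<and> k \<le> len \<alpha>} =
      {k. 1 \<le> k \<and> k < len \<alpha>} \<union> (if parts \<alpha> = [] then {} else {len \<alpha>})"
    by (cases "parts \<alpha>") (auto simp: len_def)
  then have "{sum_list (take k (parts \<alpha>)) | k. 1 \<le> k \<and> k \<le> len \<alpha>} =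
      (if parts \<alpha> = [] then {} else insert (weight \<alpha>) (descents \<alpha>))"
    unfolding descents_def weight_def setcompr_eq_image by (auto simp: len_def)
  finally show ?thesis .
qed

lemma descents_bound:
  assumes "d \<in> descents \<alpha>"
  shows "0 < d" and "d < weight \<alpha>"
proof -
  obtain k where k: "1 \<le> k" "k < len \<alpha>" "d = sum_list (take k (parts \<alpha>))"
    using assms by (auto simp: descents_def)
  have pos: "\<forall>x\<in>set (parts \<alpha>). 0 < x"
    using parts[of \<alpha>] by simp
  have sum_pos: "0 < sum_list xs" if "xs \<noteq> []" "\<forall>x\<in>set xs. 0 < x" for xs :: "nat list"
    using that by (cases xs) auto
  show "0 < d"
    unfolding k(3) using k pos by (intro sum_pos) (auto simp: len_def dest: in_set_takeD)
  have "0 < sum_list (drop k (parts \<alpha>))"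
    using k pos by (intro sum_pos) (auto simp: len_def dest: in_set_dropD)
  moreover have "weight \<alpha> = d + sum_list (drop k (parts \<alpha>))"
    unfolding weight_def k(3) by (metis append_take_drop_id sum_list_append)
  ultimately show "d < weight \<alpha>"
    by simp
qed

lemma ex1_composition:
  assumes "S \<subseteq> {1..<n}"
  shows "\<exists>!\<gamma>. \<gamma> \<Turnstile> n \<and> descents \<gamma> = S"
  using assms
proof (induction n arbitrary: S rule: less_induct)
  case (less n)
  have snoc_cases: "parts \<gamma> = [] \<or> (\<exists>\<beta> x. 0 < x \<and> parts \<gamma> = parts \<beta> @ [x])" for \<gamma>
  proof (cases "parts \<gamma>" rule: rev_cases)
    case (snoc ys y)
    then have "\<forall>x\<in>set ys. 0 < x" "0 < y"
      using parts[of \<gamma>] by auto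
    with snoc show ?thesis
      by (intro disjI2 exI[of _ "Composition ys"] exI[of _ y]) (simp add: Composition_inverse)
  qed simp
  have parts_nonempty: "parts \<beta> \<noteq> [] \<longleftrightarrow> weight \<beta> \<noteq> 0" for \<beta>
  proof -
    have "\<forall>x\<in>set (parts \<beta>). 0 < x"
      using parts[of \<beta>] by simp
    then show ?thesis
      by (cases "parts \<beta>") (auto simp: weight_def)
  qed
  have ex_snoc: "\<exists>\<gamma>. parts \<gamma> = parts \<beta> @ [x]" if "0 < x" for \<beta> x
    using that parts[of \<beta>]
    by (intro exI[of _ "Composition (parts \<beta> @ [x])"]) (auto simp: Composition_inverse)
  have fin: "finite S"
    using less.prems finite_subset by blast
  consider "n = 0" | "n > 0" "S = {}" | "n > 0" "S \<noteq> {}" by auto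
  then show ?case
  proof cases
    case 1
    have "\<gamma> \<Turnstile> n \<and> descents \<gamma> = S \<longleftrightarrow> parts \<gamma> = []" for \<gamma>
      using 1 less.prems parts_nonempty[of \<gamma>]
      by (auto simp: is_composition_of_def descents_def len_def)
    moreover have "parts \<gamma> = [] \<longleftrightarrow> \<gamma> = 0" for \<gamma>
      by transfer simp
    ultimately show ?thesis by simp
  next
    case 2
    have "\<gamma> \<Turnstile> n \<and> descents \<gamma> = S \<longleftrightarrow> parts \<gamma> = [n]" for \<gamma>
      using snoc_cases[of \<gamma>]
    proof (elim disjE exE conjE)
      assume "parts \<gamma> = []"
      then show ?thesis using 2 by (simp add: is_composition_of_def weight_def)
    next
      fix \<beta> x assume "parts \<gamma> = parts \<beta> @ [x]"
      then show ?thesis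
        using 2 descents_snoc[of \<gamma> \<beta> x]
        by (auto simp: is_composition_of_def weight_def split: if_splits)
    qed
    moreover have "parts \<gamma> = [n] \<longleftrightarrow> \<gamma> = Composition [n]" for \<gamma>
    proof
      assume "parts \<gamma> = [n]"
      then show "\<gamma> = Composition [n]"
        using parts_inverse[of \<gamma>] by simp
    next
      assume "\<gamma> = Composition [n]"
      then show "parts \<gamma> = [n]"
        using 2 by (simp add: Composition_inverse)
    qed
    ultimately show ?thesis by simp
  next
    case 3
    define m where "m = Max S"
    have m: "m \<in> S" "\<And>s. s \<in> S \<Longrightarrow> s \<le> m"
      using 3 fin by (auto simp: m_def)
    then have mn: "0 < m" "m < n"
      using less.prems by auto
    have "S - {m} \<subseteq> {1..<m}"
      using m less.prems by fastforce
    from less.IH[OF mn(2) this]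
    obtain \<beta> where \<beta>: "\<beta> \<Turnstile> m \<and> descents \<beta> = S - {m}"
      and uniq: "\<forall>\<beta>'. \<beta>' \<Turnstile> m \<and> descents \<beta>' = S - {m} \<longrightarrow> \<beta>' = \<beta>"
      by (rule ex1E)
    obtain \<gamma> where \<gamma>: "parts \<gamma> = parts \<beta> @ [n - m]"
      using ex_snoc[of "n - m" \<beta>] mn by auto
    show ?thesis
    proof (rule ex1I[of _ \<gamma>])
      show "\<gamma> \<Turnstile> n \<and> descents \<gamma> = S"
        using \<gamma> \<beta> mn m(1) parts_nonempty[of \<beta>] descents_snoc[OF \<gamma>]
        by (auto simp: is_composition_of_def weight_def)
    next
      fix \<delta> assume \<delta>: "\<delta> \<Turnstile> n \<and> descents \<delta> = S"
      have "parts \<delta> \<noteq> []"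
        using \<delta> 3 by (auto simp: is_composition_of_def weight_def)
      then obtain \<beta>' x where \<beta>': "parts \<delta> = parts \<beta>' @ [x]"
        using snoc_cases by blast
      have S: "S = insert (weight \<beta>') (descents \<beta>')"
        using \<delta> descents_snoc[OF \<beta>'] 3 by (auto split: if_splits)
      have lt: "\<And>d. d \<in> descents \<beta>' \<Longrightarrow> d < weight \<beta>'"
        by (rule descents_bound)
      have w: "weight \<beta>' = m"
        using m S lt by (metis insertCI insertE leD)
      moreover have "descents \<beta>' = S - {m}"
        using S w lt by auto
      ultimately have "\<beta>' = \<beta>"
        using uniq by (simp add: is_composition_of_def)
      moreover have "x = n - m"
        using \<delta> \<beta>' w by (auto simp: is_composition_of_def weight_def)
      ultimately have "parts \<delta> = parts \<gamma>"
        using \<beta>' \<gamma> by simp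
      then show "\<delta> = \<gamma>"
        by (simp add: parts_inject)
    qed
  qed
qed

lemma complement_props:
  "complement \<alpha> \<Turnstile> weight \<alpha>"
  "descents (complement \<alpha>) = {1..<weight \<alpha>} - descents \<alpha>"
  using theI'[OF ex1_composition[of "{1..<weight \<alpha>} - descents \<alpha>" "weight \<alpha>"]]
  by (auto simp: complement_def)


section \<open>Noncommutative symmetric functions over \<open>\<rat>(q,t)\<close>\<close>

text \<open>The fraction field of \<open>\<rat>[q][t]\<close>.\<close>

type_synonym rat_qt = "rat poly poly fract"

definition q :: rat_qt where
  "q = Fraction_Field.Fract [:[:0, 1:]:] 1"

definition t :: rat_qt where
  "t = Fraction_Field.Fract [:0, 1:] 1"

text \<open>
  The free associative algebra on \<open>h\<^sub>1, h\<^sub>2, \<dots>\<close> is the monoid algebra of the free monoid of words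
  over the positive integers, with concatenation as its monoid operation; multiplication on
  this type is the convolution product of \<^typ>\<open>'a \<Rightarrow>\<^sub>0 'b\<close>.
\<close>

type_synonym ncsym = "composition \<Rightarrow>\<^sub>0 rat_qt"

definition scale :: "rat_qt \<Rightarrow> ncsym \<Rightarrow> ncsym" where
  "scale c x = Poly_Mapping.map ((*) c) x"

lemma lookup_scale: "Poly_Mapping.lookup (scale c x) \<alpha> = c * Poly_Mapping.lookup x \<alpha>"
  unfolding scale_def Poly_Mapping.map.rep_eq when_def by simp

interpretation ncsym: vector_space scale
  by standard (rule poly_mapping_eqI; simp add: lookup_scale lookup_add distrib_left distrib_right mult.assoc)+

definition gen :: "nat \<Rightarrow> ncsym" where
  "gen k = Poly_Mapping.single (Composition [k]) 1"

definition h :: "composition \<Rightarrow> ncsym" where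
  "h \<alpha> = prod_list (map gen (parts \<alpha>))"

text \<open>The subtraction does not truncate: \<open>\<alpha> \<preceq> \<beta>\<close> implies \<open>len \<beta> \<le> len \<alpha>\<close>.\<close>

definition ribbon :: "composition \<Rightarrow> ncsym" where
  "ribbon \<alpha> = (\<Sum>\<beta> | \<alpha> \<preceq> \<beta>. scale ((-1) ^ (len \<alpha> - len \<beta>)) (h \<beta>))"

definition Htilde :: "composition \<Rightarrow> ncsym" where
  "Htilde \<alpha> =
     (\<Sum>\<beta> | \<beta> \<Turnstile> weight \<alpha>.
        scale (t ^ cstat \<alpha> \<beta> * q ^ cstat (conjugate \<alpha>) (reversal \<beta>)) (ribbon \<beta>))"

text \<open>
  The empty composition contributes \<open>Htilde 0 = 1\<close>, so the eigenvalue condition below also covers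
  degree 0, where it says that \<open>nabla 1 = 1\<close>.
\<close>

definition nabla :: "ncsym \<Rightarrow> ncsym" where
  "nabla = (THE f. Vector_Spaces.linear scale scale f \<and>
     (\<forall>\<alpha>. f (Htilde \<alpha>) = scale (t ^ nstat \<alpha> * q ^ nstat (conjugate \<alpha>)) (Htilde \<alpha>)))"

end

theory Submission
  imports Defs
begin

text \<open>
  Identify compositions of \<open>n\<close> with subsets of \<open>{1..<n}\<close>. The degree \<open>n\<close> part then becomes a
  tensor product of planes, one for each \<open>i\<close>, and the ribbon functions, the \<open>h\<close>, the \<open>Htilde\<close> and
  \<open>nabla\<close> are all related by tensor products of 2 by 2 matrices. With \<open>a = t ^ i\<close> and
  \<open>b = q ^ (n - i)\<close>, the \<open>i\<close>-th factor has ribbon basis \<open>s\<^sub>0, s\<^sub>1\<close> and eigenvectors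
  \<open>s\<^sub>0 + a s\<^sub>1\<close>, \<open>s\<^sub>0 + b s\<^sub>1\<close> for the eigenvalues \<open>a\<close>, \<open>b\<close>; since \<open>a \<noteq> b\<close> they determine the
  operator, which sends \<open>s\<^sub>1\<close> to \<open>s\<^sub>0 + (a + b) s\<^sub>1\<close> and \<open>s\<^sub>0\<close> to \<open>- a b s\<^sub>1\<close>.
\<close>

declare One_nat_def [simp del]


section \<open>Tensor products of 2 by 2 matrices\<close>

text \<open>Entry of a Kronecker product: the subsets \<open>A\<close> and \<open>B\<close> code the
  row and column multi-indices by their membership bits, and points outside \<open>N\<close> are
  ignored.\<close>

definition tensor :: "'i set \<Rightarrow> ('i \<Rightarrow> bool \<Rightarrow> bool \<Rightarrow> 'a::comm_ring_1) \<Rightarrow> 'i set \<Rightarrow> 'i set \<Rightarrow> 'a" where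
  "tensor N m A B = (\<Prod>i\<in>N. m i (i \<in> A) (i \<in> B))"

definition mult2 :: "('i \<Rightarrow> bool \<Rightarrow> bool \<Rightarrow> 'a::comm_ring_1) \<Rightarrow> ('i \<Rightarrow> bool \<Rightarrow> bool \<Rightarrow> 'a) \<Rightarrow>
    'i \<Rightarrow> bool \<Rightarrow> bool \<Rightarrow> 'a" where
  "mult2 m m' i a c = m i a True * m' i True c + m i a False * m' i False c"

lemma tensor_cong:
  assumes "\<And>i a b. i \<in> N \<Longrightarrow> m i a b = m' i a b"
  shows "tensor N m = tensor N m'"
  using assms by (intro ext) (simp add: tensor_def)

lemma tensor_one:
  assumes "finite N" "A \<subseteq> N" "B \<subseteq> N"
  shows "tensor N (\<lambda>i a b. of_bool (a = b)) A B = of_bool (A = B)"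
proof (cases "A = B")
  case False
  then obtain i where "i \<in> N" "(i \<in> A) \<noteq> (i \<in> B)"
    using assms by blast
  then have "\<exists>i\<in>N. of_bool ((i \<in> A) = (i \<in> B)) = (0::'b::comm_ring_1)"
    by (intro bexI[of _ i]) auto
  then show ?thesis
    using assms(1) False by (auto simp: tensor_def intro!: prod_zero)
qed (simp add: tensor_def)

text \<open>The product over \<open>N\<close> of the two-term sums in \<open>mult2\<close> is
  expanded; \<open>B\<close> records the factors in which the summand with middle index
  \<open>True\<close> is chosen.\<close>

lemma tensor_mult:
  assumes "finite N"
  shows "(\<Sum>B\<in>Pow N. tensor N m A B * tensor N m' B C) = tensor N (mult2 m m') A C"
proof -
  have "tensor N m A B * tensor N m' B C =
      (\<Prod>i\<in>B. m i (i \<in> A) True * m' i True (i \<in> C)) *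
      (\<Prod>i\<in>N - B. m i (i \<in> A) False * m' i False (i \<in> C))" if "B \<in> Pow N" for B
  proof -
    have "tensor N m A B * tensor N m' B C =
        (\<Prod>i\<in>N. m i (i \<in> A) (i \<in> B) * m' i (i \<in> B) (i \<in> C))"
      by (simp add: tensor_def prod.distrib)
    also have "\<dots> = (\<Prod>i\<in>N - B. m i (i \<in> A) (i \<in> B) * m' i (i \<in> B) (i \<in> C)) *
        (\<Prod>i\<in>B. m i (i \<in> A) (i \<in> B) * m' i (i \<in> B) (i \<in> C))"
      using that by (intro prod.subset_diff) (auto simp: assms)
    finally show ?thesis
      by (simp add: mult.commute)
  qed
  then show ?thesis
    by (simp add: prod_add[OF assms] tensor_def mult2_def)
qed

text \<open>Lets two successive changes of family, each given by a tensor product, be composed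
  factor by factor, for arbitrary vectors \<open>v\<close>.\<close>

lemma (in vector_space) tensor_action_mult:
  assumes "finite N"
  shows "(\<Sum>B\<in>Pow N. scale (tensor N m A B) (\<Sum>C\<in>Pow N. scale (tensor N m' B C) (v C))) =
    (\<Sum>C\<in>Pow N. scale (tensor N (mult2 m m') A C) (v C))"
proof -
  have "(\<Sum>B\<in>Pow N. scale (tensor N m A B) (\<Sum>C\<in>Pow N. scale (tensor N m' B C) (v C))) =
      (\<Sum>C\<in>Pow N. \<Sum>B\<in>Pow N. scale (tensor N m A B * tensor N m' B C) (v C))"
    by (subst sum.swap) (simp add: scale_sum_right)
  then show ?thesis
    by (simp add: scale_sum_left[symmetric] tensor_mult[OF assms])
qed

lemma (in vector_space) tensor_action_one:
  assumes "finite N" "A \<subseteq> N"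
  shows "(\<Sum>B\<in>Pow N. scale (tensor N (\<lambda>i a b. of_bool (a = b)) A B) (v B)) = v A"
proof -
  have "(\<Sum>B\<in>Pow N. scale (tensor N (\<lambda>i a b. of_bool (a = b)) A B) (v B)) =
      (\<Sum>B\<in>Pow N. if A = B then v B else 0)"
    using assms by (intro sum.cong) (auto simp: tensor_one)
  then show ?thesis
    using assms by simp
qed


section \<open>Compositions as sets\<close>

text \<open>Inverse of \<open>descents\<close> on the compositions of \<open>n\<close>; by
  \<open>ex1_composition\<close> the description denotes for \<open>S\<close> inside
  \<open>{1..<n}\<close>.\<close>

definition composition_of :: "nat \<Rightarrow> nat set \<Rightarrow> composition" where
  "composition_of n S = (THE \<gamma>. \<gamma> \<Turnstile> n \<and> descents \<gamma> = S)"

lemma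
  assumes "S \<subseteq> {1..<n}"
  shows weight_composition_of: "weight (composition_of n S) = n"
    and descents_composition_of: "descents (composition_of n S) = S"
  using theI'[OF ex1_composition[OF assms]]
  by (auto simp: composition_of_def is_composition_of_def)

lemma descents_subset: "descents \<alpha> \<subseteq> {1..<weight \<alpha>}"
  using descents_bound[of _ \<alpha>] by fastforce

lemma finite_descents: "finite (descents \<alpha>)"
  using descents_subset finite_subset by blast

lemma composition_of_descents: "composition_of (weight \<alpha>) (descents \<alpha>) = \<alpha>"
  using ex1_composition[OF descents_subset[of \<alpha>]]
  unfolding composition_of_def by (intro the1_equality) (auto simp: is_composition_of_def)

lemma sum_compositions:
  "(\<Sum>\<beta> | \<beta> \<Turnstile> n. f \<beta>) = (\<Sum>B\<in>Pow {1..<n}. f (composition_of n B))"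
proof (rule sum.reindex_bij_witness[where i = "composition_of n" and j = descents])
  show "descents \<beta> \<in> Pow {1..<n}" if "\<beta> \<in> {\<beta>. \<beta> \<Turnstile> n}" for \<beta>
    using that descents_subset[of \<beta>] by (auto simp: is_composition_of_def)
qed (auto simp: is_composition_of_def weight_composition_of descents_composition_of
      composition_of_descents)

text \<open>Appending a part to a nonempty composition adds its old weight as a descent, which
  exceeds all earlier ones. For the empty composition both sides are 0, by truncation.\<close>

lemma card_descents: "card (descents \<alpha>) = len \<alpha> - 1"
proof -
  have "card (descents \<alpha>) = length xs - 1" if "parts \<alpha> = xs" for xs
    using that
  proof (induction xs arbitrary: \<alpha> rule: rev_induct)
    case Nil
    then show ?case by (simp add: descents_def len_def)
  next
    case (snoc x xs)
    have "\<forall>y\<in>set xs. 0 < y"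
      using parts[of \<alpha>] snoc.prems by auto
    then have xs: "parts (Composition xs) = xs"
      by (simp add: Composition_inverse)
    have "weight (Composition xs) \<notin> descents (Composition xs)"
      using descents_bound by blast
    then show ?case
      using snoc.IH[OF xs] snoc.prems descents_snoc[of \<alpha> "Composition xs" x] xs
      by (cases xs) (auto simp: finite_descents)
  qed
  then show ?thesis by (simp add: len_def)
qed

lemma len_pos_iff: "0 < len \<alpha> \<longleftrightarrow> 0 < weight \<alpha>"
proof -
  have "\<forall>x\<in>set (parts \<alpha>). 0 < x"
    using parts[of \<alpha>] by simp
  then show ?thesis
    by (cases "parts \<alpha>") (auto simp: len_def weight_def)
qed

text \<open>Equal weights make the two lengths both zero or both positive, so the truncated
  \<open>- 1\<close> of \<open>card_descents\<close> cancels.\<close>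

lemma len_diff:
  assumes "weight \<alpha> = weight \<beta>" "descents \<beta> \<subseteq> descents \<alpha>"
  shows "len \<alpha> - len \<beta> = card (descents \<alpha> - descents \<beta>)"
  using assms card_Diff_subset[OF finite_descents assms(2)] card_descents[of \<alpha>] card_descents[of \<beta>]
    len_pos_iff[of \<alpha>] len_pos_iff[of \<beta>] by (cases "weight \<alpha>") auto

text \<open>A partial sum of the reversed list is the total minus the complementary partial sum of
  the original list.\<close>

lemma descents_reversal: "descents (reversal \<alpha>) = (\<lambda>i. weight \<alpha> - i) ` descents \<alpha>"
proof -
  let ?xs = "parts \<alpha>" and ?s = "\<lambda>k. sum_list (take k (parts \<alpha>))"
  have eq: "sum_list (take k (rev ?xs)) = weight \<alpha> - ?s (len \<alpha> - k)" for k
  proof -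
    have "sum_list ?xs = ?s (len \<alpha> - k) + sum_list (drop (len \<alpha> - k) ?xs)"
      by (metis append_take_drop_id sum_list_append)
    then show ?thesis
      by (simp add: take_rev len_def weight_def)
  qed
  have "descents (reversal \<alpha>) = (\<lambda>k. weight \<alpha> - ?s (len \<alpha> - k)) ` {1..<len \<alpha>}"
    by (auto simp: descents_def len_def[of "reversal \<alpha>"] reversal.rep_eq eq len_def[symmetric])
  also have "\<dots> = (\<lambda>k. weight \<alpha> - ?s k) ` (\<lambda>k. len \<alpha> - k) ` {1..<len \<alpha>}"
    by (simp add: image_image)
  also have "(\<lambda>k. len \<alpha> - k) ` {1..<len \<alpha>} = {1..<len \<alpha>}"
  proof (intro equalityI subsetI)
    show "k \<in> (\<lambda>k. len \<alpha> - k) ` {1..<len \<alpha>}" if "k \<in> {1..<len \<alpha>}" for k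
      using that by (intro image_eqI[of _ _ "len \<alpha> - k"]) auto
  qed auto
  also have "(\<lambda>k. weight \<alpha> - ?s k) ` {1..<len \<alpha>} = (\<lambda>i. weight \<alpha> - i) ` descents \<alpha>"
  proof -
    have "descents \<alpha> = ?s ` {1..<len \<alpha>}"
      by (auto simp: descents_def)
    then show ?thesis
      by (simp add: image_image)
  qed
  finally show ?thesis .
qed

lemma weight_complement: "weight (complement \<alpha>) = weight \<alpha>"
  using complement_props(1) by (simp add: is_composition_of_def)

lemma descents_conjugate:
  "descents (conjugate \<alpha>) = (\<lambda>i. weight \<alpha> - i) ` ({1..<weight \<alpha>} - descents \<alpha>)"
  by (simp add: conjugate_def descents_reversal weight_complement complement_props(2))

lemma inj_on_minus: "inj_on (\<lambda>i. n - i) {1..<n::nat}"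
  by (auto simp: inj_on_def)

lemma nstat_conjugate:
  "nstat (conjugate \<alpha>) = (\<Sum>i\<in>{1..<weight \<alpha>} - descents \<alpha>. weight \<alpha> - i)"
  unfolding nstat_def descents_conjugate
  by (subst sum.reindex) (auto intro: inj_on_subset[OF inj_on_minus])

text \<open>Both descent sets are images under the same injective reflection of
  \<open>{1..<weight \<alpha>}\<close>, so they can be intersected before reflecting.\<close>

lemma cstat_conjugate_reversal:
  assumes "weight \<beta> = weight \<alpha>"
  shows "cstat (conjugate \<alpha>) (reversal \<beta>) = (\<Sum>i\<in>descents \<beta> - descents \<alpha>. weight \<alpha> - i)"
proof -
  have sub: "descents \<beta> \<subseteq> {1..<weight \<alpha>}"
    using descents_subset[of \<beta>] assms by simp
  have "descents (conjugate \<alpha>) \<inter> descents (reversal \<beta>) =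
      (\<lambda>i. weight \<alpha> - i) ` (({1..<weight \<alpha>} - descents \<alpha>) \<inter> descents \<beta>)"
    using sub unfolding descents_conjugate descents_reversal assms
    by (intro inj_on_image_Int[OF inj_on_minus, symmetric]) auto
  also have "({1..<weight \<alpha>} - descents \<alpha>) \<inter> descents \<beta> = descents \<beta> - descents \<alpha>"
    using sub by auto
  finally have eq: "descents (conjugate \<alpha>) \<inter> descents (reversal \<beta>) =
      (\<lambda>i. weight \<alpha> - i) ` (descents \<beta> - descents \<alpha>)" .
  have "inj_on (\<lambda>i. weight \<alpha> - i) (descents \<beta> - descents \<alpha>)"
    using sub by (intro inj_on_subset[OF inj_on_minus]) auto
  then show ?thesis
    unfolding cstat_def eq by (simp add: sum.reindex)
qed


section \<open>Transition matrices\<close>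

text \<open>One factor of the Moebius function of the Boolean lattice; \<open>zeta2\<close> is the
  matching factor of its zeta function.\<close>

definition moebius2 :: "nat \<Rightarrow> bool \<Rightarrow> bool \<Rightarrow> rat_qt" where
  "moebius2 i a b = (if a then if b then 1 else - 1 else if b then 0 else 1)"

definition zeta2 :: "nat \<Rightarrow> bool \<Rightarrow> bool \<Rightarrow> rat_qt" where
  "zeta2 i a b = (if b \<and> \<not> a then 0 else 1)"

text \<open>Each row lists the ribbon coordinates of one eigenvector of the \<open>i\<close>-th
  factor.\<close>

definition Htilde2 :: "nat \<Rightarrow> nat \<Rightarrow> bool \<Rightarrow> bool \<Rightarrow> rat_qt" where
  "Htilde2 n i a b = (if b then if a then t ^ i else q ^ (n - i) else 1)"

text \<open>The adjugate of \<open>Htilde2\<close> divided by its determinant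
  \<open>t ^ i - q ^ (n - i)\<close>.\<close>

definition Htilde2_inv :: "nat \<Rightarrow> nat \<Rightarrow> bool \<Rightarrow> bool \<Rightarrow> rat_qt" where
  "Htilde2_inv n i a b =
     (if a then if b then 1 else - 1 else if b then - (q ^ (n - i)) else t ^ i) /
     (t ^ i - q ^ (n - i))"

definition eigen2 :: "nat \<Rightarrow> nat \<Rightarrow> bool \<Rightarrow> rat_qt" where
  "eigen2 n i a = (if a then t ^ i else q ^ (n - i))"

text \<open>Row \<open>a\<close> holds the ribbon coordinates of the image of the basis vector
  indexed by \<open>a\<close>, so operators act on coordinate rows from the right.\<close>

definition nabla2 :: "nat \<Rightarrow> nat \<Rightarrow> bool \<Rightarrow> bool \<Rightarrow> rat_qt" where
  "nabla2 n i a b =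
     (if a then if b then t ^ i + q ^ (n - i) else 1
      else if b then - (t ^ i * q ^ (n - i)) else 0)"

lemma mult2_moebius2_zeta2: "mult2 moebius2 zeta2 = (\<lambda>i a b. of_bool (a = b))"
  by (intro ext) (auto simp: mult2_def moebius2_def zeta2_def)

lemma mult2_zeta2_moebius2: "mult2 zeta2 moebius2 = (\<lambda>i a b. of_bool (a = b))"
  by (intro ext) (auto simp: mult2_def moebius2_def zeta2_def)

text \<open>The rows of \<open>Htilde2\<close> are left eigenvectors of \<open>nabla2\<close>, whose
  trace and determinant are the sum and the product of the two eigenvalues.\<close>

lemma mult2_Htilde2_nabla2:
  "mult2 (Htilde2 n) (nabla2 n) = (\<lambda>i a b. eigen2 n i a * Htilde2 n i a b)"
  by (intro ext) (auto simp: mult2_def Htilde2_def nabla2_def eigen2_def algebra_simps)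

text \<open>Compare degrees in the outer variable \<open>t\<close>: one side has degree
  \<open>i\<close>, the other is constant. This makes \<open>Htilde2\<close> invertible.\<close>

lemma t_power_neq_q_power:
  assumes "0 < i"
  shows "t ^ i \<noteq> q ^ j"
proof
  have Fract_power: "Fraction_Field.Fract p 1 ^ k = Fraction_Field.Fract (p ^ k) 1"
    for p :: "rat poly poly" and k
    by (induction k) (simp_all add: One_fract_def)
  assume "t ^ i = q ^ j"
  then have eq: "[:0, 1:] ^ i = [:[:0, 1::rat:]:] ^ j"
    by (simp add: t_def q_def Fract_power eq_fract)
  have "degree ([:0, 1::rat poly:] ^ i) = i"
    by (simp add: degree_power_eq)
  moreover have "degree ([:[:0, 1::rat:]:] ^ j) = 0"
    by (simp add: degree_power_eq)
  ultimately show False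
    using eq assms by simp
qed

lemma mult2_Htilde2_inv_Htilde2:
  assumes "0 < i"
  shows "mult2 (Htilde2_inv n) (Htilde2 n) i a b = of_bool (a = b)"
  using t_power_neq_q_power[OF assms, of "n - i"]
  by (auto simp: mult2_def Htilde2_inv_def Htilde2_def divide_simps)


section \<open>The bases\<close>

text \<open>In the monoid algebra of words a product of generators is the word itself, so the
  \<open>h\<close> form the standard basis.\<close>

lemma h_eq_single: "h \<alpha> = Poly_Mapping.single \<alpha> 1"
proof -
  have "prod_list (map gen xs) = Poly_Mapping.single (Composition xs) 1" if "\<forall>x\<in>set xs. 0 < x" for xs
    using that
  proof (induction xs)
    case Nil
    then show ?case by (simp add: zero_composition_def single_one[symmetric])
  next
    case (Cons x xs)
    have "Composition [x] + Composition xs = Composition (x # xs)"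
      using Cons.prems by (intro parts_inject[THEN iffD1])
        (simp add: plus_composition.rep_eq Composition_inverse)
    then show ?case
      using Cons by (simp add: gen_def mult_single)
  qed
  then show ?thesis
    using parts[of \<alpha>] by (simp add: h_def parts_inverse)
qed

text \<open>A point of \<open>B\<close> outside \<open>descents \<alpha>\<close> gives a factor 0,
  and each point of \<open>descents \<alpha> - B\<close> gives a sign; \<open>len_diff\<close>
  counts these signs.\<close>

lemma ribbon_eq_tensor:
  assumes "\<alpha> \<Turnstile> n"
  shows "ribbon \<alpha> =
    (\<Sum>B\<in>Pow {1..<n}. scale (tensor {1..<n} moebius2 (descents \<alpha>) B) (h (composition_of n B)))"
proof -
  have n: "weight \<alpha> = n"
    using assms by (simp add: is_composition_of_def)
  have sub: "descents \<alpha> \<subseteq> {1..<n}"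
    using descents_subset[of \<alpha>] n by simp
  have coeff: "tensor {1..<n} moebius2 (descents \<alpha>) B =
      (if B \<subseteq> descents \<alpha> then (-1) ^ card (descents \<alpha> - B) else 0)" if "B \<subseteq> {1..<n}" for B
  proof (cases "B \<subseteq> descents \<alpha>")
    case True
    have "tensor {1..<n} moebius2 (descents \<alpha>) B =
        (\<Prod>i\<in>{1..<n}. if i \<in> descents \<alpha> - B then -1 else 1)"
      unfolding tensor_def using True by (intro prod.cong) (auto simp: moebius2_def)
    also have "\<dots> = (\<Prod>i\<in>descents \<alpha> - B. -1)"
      using sub by (intro prod.mono_neutral_cong_right) auto
    finally show ?thesis using True by simp
  next
    case False
    then show ?thesis
      using that unfolding tensor_def by (auto simp: moebius2_def)
  qed
  have "ribbon \<alpha> = (\<Sum>\<beta> | \<beta> \<Turnstile> n. if \<alpha> \<preceq> \<beta> then scale ((-1) ^ (len \<alpha> - len \<beta>)) (h \<beta>) else 0)"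
    unfolding ribbon_def
    by (rule sum.mono_neutral_cong_left)
      (use finite_compositions[of n] in \<open>auto simp: finer_def is_composition_of_def n\<close>)
  also have "\<dots> = (\<Sum>B\<in>Pow {1..<n}.
      scale (tensor {1..<n} moebius2 (descents \<alpha>) B) (h (composition_of n B)))"
    unfolding sum_compositions
    by (intro sum.cong)
      (auto simp: coeff finer_def n weight_composition_of descents_composition_of len_diff)
  finally show ?thesis .
qed

lemma ribbon_composition_of:
  assumes "A \<subseteq> {1..<n}"
  shows "ribbon (composition_of n A) =
    (\<Sum>B\<in>Pow {1..<n}. scale (tensor {1..<n} moebius2 A B) (h (composition_of n B)))"
  using ribbon_eq_tensor[of "composition_of n A" n] assms
  by (simp add: is_composition_of_def weight_composition_of descents_composition_of)

text \<open>Moebius inversion: expanding the ribbons on the right produces \<open>zeta2\<close>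
  times \<open>moebius2\<close>, the identity.\<close>

lemma h_composition_of:
  assumes "A \<subseteq> {1..<n}"
  shows "h (composition_of n A) =
    (\<Sum>B\<in>Pow {1..<n}. scale (tensor {1..<n} zeta2 A B) (ribbon (composition_of n B)))"
  using assms
  by (simp add: ribbon_composition_of ncsym.tensor_action_mult mult2_zeta2_moebius2
      ncsym.tensor_action_one)

text \<open>A point of \<open>B\<close> contributes a power of \<open>t\<close> or of
  \<open>q\<close> according to whether it lies in \<open>A\<close>;
  \<open>cstat_conjugate_reversal\<close> identifies the total exponent of \<open>q\<close>.\<close>

lemma Htilde_composition_of:
  assumes "A \<subseteq> {1..<n}"
  shows "Htilde (composition_of n A) =
    (\<Sum>B\<in>Pow {1..<n}. scale (tensor {1..<n} (Htilde2 n) A B) (ribbon (composition_of n B)))"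
proof -
  have coeff: "tensor {1..<n} (Htilde2 n) A B = t ^ \<Sum>(A \<inter> B) * q ^ (\<Sum>i\<in>B - A. n - i)"
    if "B \<subseteq> {1..<n}" for B
  proof -
    have "tensor {1..<n} (Htilde2 n) A B =
        (\<Prod>i\<in>{1..<n}. if i \<in> A \<inter> B then t ^ i else 1) *
        (\<Prod>i\<in>{1..<n}. if i \<in> B - A then q ^ (n - i) else 1)"
      unfolding tensor_def prod.distrib[symmetric]
      by (intro prod.cong) (auto simp: Htilde2_def)
    also have "(\<Prod>i\<in>{1..<n}. if i \<in> A \<inter> B then t ^ i else 1) = (\<Prod>i\<in>A \<inter> B. t ^ i)"
      using that by (intro prod.mono_neutral_cong_right) auto
    also have "(\<Prod>i\<in>{1..<n}. if i \<in> B - A then q ^ (n - i) else 1) = (\<Prod>i\<in>B - A. q ^ (n - i))"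
      using that by (intro prod.mono_neutral_cong_right) auto
    finally show ?thesis by (simp add: power_sum)
  qed
  show ?thesis
    unfolding Htilde_def sum_compositions weight_composition_of[OF assms]
    using assms
    by (intro sum.cong) (auto simp: coeff cstat_def[of "composition_of n A" "composition_of n B" for B]
        cstat_conjugate_reversal weight_composition_of descents_composition_of)
qed

lemma ribbon_eq_Htilde:
  assumes "A \<subseteq> {1..<n}"
  shows "ribbon (composition_of n A) =
    (\<Sum>B\<in>Pow {1..<n}. scale (tensor {1..<n} (Htilde2_inv n) A B) (Htilde (composition_of n B)))"
proof -
  have "tensor {1..<n} (mult2 (Htilde2_inv n) (Htilde2 n)) =
      tensor {1..<n} (\<lambda>i a b. of_bool (a = b))"
    \<comment> \<open>The factorwise inverse relation is available for positive \<open>i\<close>,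
      hence on all of \<open>{1..<n}\<close>.\<close>
    by (intro tensor_cong) (auto simp: mult2_Htilde2_inv_Htilde2)
  then show ?thesis
    using assms
    by (simp add: Htilde_composition_of ncsym.tensor_action_mult ncsym.tensor_action_one)
qed

lemma poly_mapping_eq_sum_h:
  "x = (\<Sum>\<gamma>\<in>Poly_Mapping.keys x. scale (Poly_Mapping.lookup x \<gamma>) (h \<gamma>))"
proof (rule poly_mapping_eqI)
  fix k
  have "(\<Sum>\<gamma>\<in>Poly_Mapping.keys x. Poly_Mapping.lookup x \<gamma> * (if \<gamma> = k then 1 else 0)) =
      (\<Sum>\<gamma>\<in>Poly_Mapping.keys x. if \<gamma> = k then Poly_Mapping.lookup x k else 0)"
    by (intro sum.cong) auto
  then show "Poly_Mapping.lookup x k = Poly_Mapping.lookup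
      (\<Sum>\<gamma>\<in>Poly_Mapping.keys x. scale (Poly_Mapping.lookup x \<gamma>) (h \<gamma>)) k"
    by (simp add: lookup_sum lookup_scale h_eq_single lookup_single when_def in_keys_iff)
qed

text \<open>Gives the uniqueness of \<open>nabla\<close>: the span contains the ribbons, hence the
  \<open>h\<close>, hence everything.\<close>

lemma span_Htilde: "ncsym.span (range Htilde) = UNIV"
proof -
  have "ribbon \<alpha> \<in> ncsym.span (range Htilde)" for \<alpha>
    using ribbon_eq_Htilde[OF descents_subset[of \<alpha>]]
    by (simp add: composition_of_descents ncsym.span_sum ncsym.span_scale ncsym.span_base)
  then have "h \<alpha> \<in> ncsym.span (range Htilde)" for \<alpha>
    using h_composition_of[OF descents_subset[of \<alpha>]]
    by (simp add: composition_of_descents ncsym.span_sum ncsym.span_scale)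
  then have "x \<in> ncsym.span (range Htilde)" for x
    by (subst poly_mapping_eq_sum_h) (simp add: ncsym.span_sum ncsym.span_scale)
  then show ?thesis by blast
qed


section \<open>The operator\<close>

text \<open>The linear extension of values \<open>g\<close> prescribed on the basis
  \<open>h\<close>, in which \<open>lookup x\<close> gives the coordinates.\<close>

definition extend :: "(composition \<Rightarrow> ncsym) \<Rightarrow> ncsym \<Rightarrow> ncsym" where
  "extend g x = (\<Sum>\<gamma>\<in>Poly_Mapping.keys x. scale (Poly_Mapping.lookup x \<gamma>) (g \<gamma>))"

text \<open>Sums and multiples can have smaller support; a common index set \<open>S\<close> allows
  termwise comparison.\<close>

lemma extend_eq:
  assumes "finite S" "Poly_Mapping.keys x \<subseteq> S"
  shows "extend g x = (\<Sum>\<gamma>\<in>S. scale (Poly_Mapping.lookup x \<gamma>) (g \<gamma>))"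
  unfolding extend_def using assms
  by (intro sum.mono_neutral_left) (auto simp: in_keys_iff)

lemma linear_extend: "Vector_Spaces.linear scale scale (extend g)"
proof (unfold Vector_Spaces.linear_def module_hom_def module_hom_axioms_def, intro conjI allI)
  fix x y :: ncsym and c
  let ?S = "Poly_Mapping.keys x \<union> Poly_Mapping.keys y"
  show "extend g (x + y) = extend g x + extend g y"
    using Poly_Mapping.keys_add[of x y]
    by (simp add: extend_eq[where S = ?S] lookup_add ncsym.scale_left_distrib sum.distrib)
  have "Poly_Mapping.keys (scale c x) \<subseteq> Poly_Mapping.keys x"
    by (auto simp: in_keys_iff lookup_scale)
  then show "extend g (scale c x) = scale c (extend g x)"
    by (simp add: extend_eq[where S = "Poly_Mapping.keys x"] lookup_scale ncsym.scale_sum_right)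
qed (use ncsym.vector_space_axioms ncsym.module_axioms in auto)

lemma extend_h: "extend g (h \<alpha>) = g \<alpha>"
  by (simp add: extend_def h_eq_single)

lemma linear_sum_scale:
  assumes "Vector_Spaces.linear scale scale f"
  shows "f (\<Sum>i\<in>I. scale (c i) (v i)) = (\<Sum>i\<in>I. scale (c i) (f (v i)))"
proof -
  interpret f: Vector_Spaces.linear scale scale f by (rule assms)
  show ?thesis by (simp add: f.sum f.scale)
qed

text \<open>The candidate operator on \<open>h\<close>: pass to ribbons by \<open>zeta2\<close>,
  then apply \<open>nabla2\<close>. Values on the basis \<open>h\<close> can be prescribed
  freely.\<close>

definition nabla_on_h :: "composition \<Rightarrow> ncsym" where
  "nabla_on_h \<gamma> = (\<Sum>B\<in>Pow {1..<weight \<gamma>}.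
     scale (tensor {1..<weight \<gamma>} (mult2 zeta2 (nabla2 (weight \<gamma>))) (descents \<gamma>) B)
       (ribbon (composition_of (weight \<gamma>) B)))"

text \<open>Passing from ribbons to \<open>h\<close> brings in \<open>moebius2\<close>, which
  cancels the \<open>zeta2\<close> inside \<open>nabla_on_h\<close>.\<close>

lemma extend_nabla_on_h_ribbon:
  assumes "A \<subseteq> {1..<n}"
  shows "extend nabla_on_h (ribbon (composition_of n A)) =
    (\<Sum>B\<in>Pow {1..<n}. scale (tensor {1..<n} (nabla2 n) A B) (ribbon (composition_of n B)))"
proof -
  let ?R = "\<lambda>B. \<Sum>C\<in>Pow {1..<n}. scale (tensor {1..<n} (nabla2 n) B C) (ribbon (composition_of n C))"
  have "extend nabla_on_h (ribbon (composition_of n A)) =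
      (\<Sum>B\<in>Pow {1..<n}. scale (tensor {1..<n} moebius2 A B) (nabla_on_h (composition_of n B)))"
    using assms by (simp add: ribbon_composition_of linear_sum_scale[OF linear_extend] extend_h)
  also have "\<dots> = (\<Sum>B\<in>Pow {1..<n}. scale (tensor {1..<n} moebius2 A B)
      (\<Sum>C\<in>Pow {1..<n}. scale (tensor {1..<n} zeta2 B C) (?R C)))"
    by (intro sum.cong) (auto simp: nabla_on_h_def weight_composition_of descents_composition_of
        ncsym.tensor_action_mult)
  also have "\<dots> = ?R A"
    using assms ncsym.tensor_action_mult[of "{1..<n}" moebius2 A zeta2 ?R]
      ncsym.tensor_action_one[of "{1..<n}" A ?R]
    by (simp only: mult2_moebius2_zeta2 finite_atLeastLessThan)
  finally show ?thesis .
qed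

lemma eigenvalue_eq_prod:
  "t ^ nstat \<alpha> * q ^ nstat (conjugate \<alpha>) =
    (\<Prod>i\<in>{1..<weight \<alpha>}. eigen2 (weight \<alpha>) i (i \<in> descents \<alpha>))"
proof -
  have "(\<Prod>i\<in>{1..<weight \<alpha>}. eigen2 (weight \<alpha>) i (i \<in> descents \<alpha>)) =
      (\<Prod>i\<in>{1..<weight \<alpha>} - descents \<alpha>. eigen2 (weight \<alpha>) i (i \<in> descents \<alpha>)) *
      (\<Prod>i\<in>descents \<alpha>. eigen2 (weight \<alpha>) i (i \<in> descents \<alpha>))"
    by (intro prod.subset_diff descents_subset) auto
  then show ?thesis
    by (simp add: eigen2_def nstat_conjugate power_sum) (simp add: nstat_def power_sum mult.commute)
qed

text \<open>The eigenvector relation holds in every factor, and the eigenvalues of the factors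
  multiply by \<open>eigenvalue_eq_prod\<close>.\<close>

lemma extend_nabla_on_h_Htilde:
  "extend nabla_on_h (Htilde \<alpha>) =
    scale (t ^ nstat \<alpha> * q ^ nstat (conjugate \<alpha>)) (Htilde \<alpha>)"
proof -
  let ?n = "weight \<alpha>" and ?A = "descents \<alpha>"
  let ?N = "{1..<?n}"
  have H: "Htilde \<alpha> =
      (\<Sum>B\<in>Pow ?N. scale (tensor ?N (Htilde2 ?n) ?A B) (ribbon (composition_of ?n B)))"
    using Htilde_composition_of[OF descents_subset[of \<alpha>]] by (simp add: composition_of_descents)
  have "extend nabla_on_h (Htilde \<alpha>) =
      (\<Sum>B\<in>Pow ?N. scale (tensor ?N (mult2 (Htilde2 ?n) (nabla2 ?n)) ?A B)
        (ribbon (composition_of ?n B)))"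
    by (simp add: H linear_sum_scale[OF linear_extend] extend_nabla_on_h_ribbon
        ncsym.tensor_action_mult)
  also have "tensor ?N (mult2 (Htilde2 ?n) (nabla2 ?n)) ?A =
      (\<lambda>B. (t ^ nstat \<alpha> * q ^ nstat (conjugate \<alpha>)) * tensor ?N (Htilde2 ?n) ?A B)"
    by (intro ext) (simp add: mult2_Htilde2_nabla2 eigenvalue_eq_prod tensor_def prod.distrib)
  finally show ?thesis
    by (simp add: H ncsym.scale_sum_right)
qed

text \<open>The candidate has the required eigenvectors, and a linear map is determined by its
  values on the spanning family \<open>Htilde\<close>.\<close>

lemma nabla_eq_extend: "nabla = extend nabla_on_h"
  unfolding nabla_def
proof (rule the_equality, intro conjI allI)
  interpret vector_space_pair scale scale ..
  show "f = extend nabla_on_h"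
    if "Vector_Spaces.linear scale scale f \<and>
      (\<forall>\<alpha>. f (Htilde \<alpha>) = scale (t ^ nstat \<alpha> * q ^ nstat (conjugate \<alpha>)) (Htilde \<alpha>))" for f
  proof
    fix x
    show "f x = extend nabla_on_h x"
      using that span_Htilde
      by (intro linear_eq_on[OF _ linear_extend, of f x "range Htilde"])
        (auto simp: extend_nabla_on_h_Htilde)
  qed
qed (simp_all add: linear_extend extend_nabla_on_h_Htilde)

text \<open>Non-descents of \<open>\<alpha>\<close> force the condition on \<open>B\<close> and
  yield the scalar in front; descents yield \<open>t ^ i + q ^ (n - i)\<close> when in
  \<open>B\<close> and 1 otherwise.\<close>

lemma tensor_nabla2:
  assumes "\<alpha> \<Turnstile> n" "B \<subseteq> {1..<n}"
  shows "tensor {1..<n} (nabla2 n) (descents \<alpha>) B =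
    (if {1..<n} - descents \<alpha> \<subseteq> B
     then ((-1) ^ (n + len \<alpha>) * q ^ nstat (conjugate \<alpha>) * t ^ nstat (complement \<alpha>)) *
       (\<Prod>i\<in>descents \<alpha> \<inter> B. t ^ i + q ^ (n - i))
     else 0)"
proof (cases "{1..<n} - descents \<alpha> \<subseteq> B")
  case True
  let ?A = "descents \<alpha>" and ?m = "\<lambda>i. nabla2 n i (i \<in> descents \<alpha>) (i \<in> B)"
  have n: "weight \<alpha> = n"
    using assms by (simp add: is_composition_of_def)
  have sub: "?A \<subseteq> {1..<n}"
    using descents_subset[of \<alpha>] n by simp
  have card: "card ({1..<n} - ?A) = n - 1 - (len \<alpha> - 1)"
    using card_Diff_subset[OF finite_descents sub] by (simp add: card_descents)
  have "card ?A \<le> n - 1"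
    using card_mono[OF _ sub] by simp
  then have "len \<alpha> \<le> n"
    using len_pos_iff[of \<alpha>] n by (cases n) (auto simp: card_descents)
  \<comment> \<open>There are \<open>n - len \<alpha>\<close> non-descents, also in degree 0, which
    has the parity of \<open>n + len \<alpha>\<close>.\<close>
  then have exponent: "n + len \<alpha> = card ({1..<n} - ?A) + 2 * len \<alpha>"
    using card len_pos_iff[of \<alpha>] n by auto
  then have sign: "(-1) ^ card ({1..<n} - ?A) = (-1 :: rat_qt) ^ (n + len \<alpha>)"
    by (simp add: exponent power_add[of _ "card _"] power_mult)
  have "(\<Prod>i\<in>{1..<n} - ?A. ?m i) = (\<Prod>i\<in>{1..<n} - ?A. - 1 * (q ^ (n - i) * t ^ i))"
    using True by (intro prod.cong) (auto simp: nabla2_def)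
  also have "\<dots> = (-1) ^ (n + len \<alpha>) * q ^ nstat (conjugate \<alpha>) * t ^ nstat (complement \<alpha>)"
    unfolding prod.distrib prod_constant sign nstat_conjugate n
    by (simp add: nstat_def complement_props(2) n power_sum)
  finally have 1: "(\<Prod>i\<in>{1..<n} - ?A. ?m i) =
      (-1) ^ (n + len \<alpha>) * q ^ nstat (conjugate \<alpha>) * t ^ nstat (complement \<alpha>)" .
  have 2: "(\<Prod>i\<in>?A. ?m i) = (\<Prod>i\<in>?A \<inter> B. t ^ i + q ^ (n - i))"
    by (intro prod.mono_neutral_cong_right) (auto simp: nabla2_def finite_descents)
  have "tensor {1..<n} (nabla2 n) ?A B = (\<Prod>i\<in>{1..<n} - ?A. ?m i) * (\<Prod>i\<in>?A. ?m i)"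
    unfolding tensor_def by (intro prod.subset_diff sub) simp
  then show ?thesis
    using True by (simp only: 1 2 if_True)
next
  case False
  then obtain i where "i \<in> {1..<n}" "i \<notin> descents \<alpha>" "i \<notin> B"
    by blast
  then have "tensor {1..<n} (nabla2 n) (descents \<alpha>) B = 0"
    unfolding tensor_def by (intro prod_zero) (auto simp: nabla2_def intro!: bexI[of _ i])
  then show ?thesis
    using False by simp
qed

theorem proposition21:
  fixes \<alpha> :: composition and n :: nat
  assumes "0 < n" and "\<alpha> \<Turnstile> n"
  shows "nabla (ribbon \<alpha>) =
    scale ((-1) ^ (n + len \<alpha>) * q ^ nstat (conjugate \<alpha>) * t ^ nstat (complement \<alpha>))
      (\<Sum>\<beta> | \<beta> \<preceq> complement \<alpha>.
         scale (\<Prod>i \<in> descents \<alpha> \<inter> descents \<beta>. t ^ i + q ^ (n - i)) (ribbon \<beta>))"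
    (is "_ = scale ?c (\<Sum>\<beta> | _. scale (?p (descents \<beta>)) _)")
proof -
  let ?N = "{1..<n}"
  have n: "weight \<alpha> = n"
    using assms by (simp add: is_composition_of_def)
  \<comment> \<open>Being finer than the complement means containing every non-descent of
    \<open>\<alpha>\<close>, which is the case distinction in \<open>tensor_nabla2\<close>.\<close>
  have "(\<Sum>\<beta> | \<beta> \<preceq> complement \<alpha>. scale (?p (descents \<beta>)) (ribbon \<beta>)) =
      (\<Sum>\<beta> | \<beta> \<Turnstile> n. if ?N - descents \<alpha> \<subseteq> descents \<beta>
        then scale (?p (descents \<beta>)) (ribbon \<beta>) else 0)"
    by (rule sum.mono_neutral_cong_left)
      (use finite_compositions[of n] in \<open>auto simp: finer_def is_composition_of_def
        weight_complement complement_props(2) n\<close>)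
  also have "scale ?c \<dots> =
      (\<Sum>B\<in>Pow ?N. scale (tensor ?N (nabla2 n) (descents \<alpha>) B) (ribbon (composition_of n B)))"
    unfolding sum_compositions ncsym.scale_sum_right
    by (intro sum.cong) (auto simp: tensor_nabla2[OF assms(2)] descents_composition_of)
  also have "\<dots> = nabla (ribbon \<alpha>)"
    using extend_nabla_on_h_ribbon[OF descents_subset[of \<alpha>]] composition_of_descents[of \<alpha>]
    by (simp add: nabla_eq_extend n)
  finally show ?thesis ..
qed

end
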